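(* Let $(\mathcal{A},\odot,\mathfrak{B})$ be a quadratic Zinbiel superalgebra over a field $\mathbb{K}$ of dimension $(n,m)$ (i.e. $\dim\mathcal{A}_{\bar 0}=n$, $\dim\mathcal{A}_{\bar 1}=m$) such that $m\ge 2$. If ${\rm Ann}(\mathcal{A})\cap\mathcal{A}_{\bar 1}\neq\{0\}$, then $\mathcal{A}$ is isomorphic to an odd double extension of a quadratic Zinbiel superalgebra $(\mathcal{H},\cdot,\mathfrak{B}_{\mathcal{H}})$ of dimension $(n,m-2)$ by the one-dimensional $\mathbb{Z}_2$-graded vector space with even part zero.
   Context: A superalgebra is a finite-dimensional $\mathbb{Z}_2$-graded vector space $\mathcal{A}=\mathcal{A}_{\bar 0}\oplus\mathcal{A}_{\bar 1}$ over $\mathbb{K}$ with a bilinear product satisfying $\mathcal{A}_i\mathcal{A}_j\subset\mathcal{A}_{i+j}$; $|x|$ is the degree of a homogeneous $x$. Left Zinbiel: $(xy)z=x(yz)+(-1)^{|y||z|}x(zy)$; right Zinbiel: $x(yz)=(xy)z+(-1)^{|x||y|}(yx)z$ (for homogeneous elements); symmetric Zinbiel: both. ${\rm Ann}(\mathcal{A})=\{a: a\mathcal{A}=\mathcal{A}a=0\}$, and $\mathcal{A}^2$ is the span of all products. A quadratic Zinbiel superalgebra is a left (or right) Zinbiel superalgebra with a non-degenerate bilinear form $\mathfrak{B}$ that is supersymmetric ($\mathfrak{B}(x,y)=(-1)^{|x||y|}\mathfrak{B}(y,x)$), invariant ($\mathfrak{B}(xy,z)=\mathfrak{B}(x,yz)$)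 and even ($\mathfrak{B}(\mathcal{A}_{\bar 0},\mathcal{A}_{\bar 1})=\mathfrak{B}(\mathcal{A}_{\bar 1},\mathcal{A}_{\bar 0})=0$). Such a superalgebra is automatically symmetric Zinbiel. Admissible triple: let $\mathcal{H}$ be a symmetric Zinbiel superalgebra, $\delta,D$ homogeneous endomorphisms of $\mathcal{H}$ of degree $|d|$, and $\mathfrak{a}_0\in{\rm Ann}(\mathcal{H})\cap\mathcal{H}_{\bar 0}$. $(\delta,D,\mathfrak{a}_0)$ is admissible if for all homogeneous $x,y\in\mathcal{H}$: $\delta(xy)=(-1)^{|d||x|}x\delta(y)=\delta(x)y+(-1)^{|d||x|}D(x)y=-(-1)^{|y|(|x|+|d|)}D(y)x$; $\delta(x)y=(-1)^{|x||y|}\delta(y)x=-(-1)^{|d|(|x|+|y|)}xD(y)$; $D(xy)=(-1)^{|d||y|}D(x)y$; $\delta^2(x)=(-1)^{|d|}\delta^2(x)=-D^2(x)=(1+(-1)^{|d|})\mathfrak{a}_0x$; $\delta\circ D(x)=-(-1)^{|d|}D\circ\delta(x)=(-1)^{|d||x|}x\mathfrak{a}_0=-(-1)^{|d|(|x|+|d|)}\mathfrak{a}_0x$; $\delta(\mathfrak{a}_0)=D(\mathfrak{a}_0)=0$. Odd double extension: let $(\mathcal{H},\cdot,\mathfrak{B}_{\mathcal{H}})$ be a quadratic Zinbiel superalgebra, $\mathcal{N}=\mathcal{N}_{\bar 1}=\mathbb{K}d$ with $d$ odd, and $(\delta,D,\mathfrak{a}_0)$ an admissible triple of $\mathcal{H}$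 (with $|d|=\bar 1$, so $\delta,D$ odd) such that $\delta(\mathcal{H})\subseteq{\rm Ann}(\mathcal{H})$, $\delta(\mathcal{H}^2)=\{0\}$, $\delta\circ D=D\circ\delta=0$, $\mathfrak{a}_0\in{\rm Ann}(\mathcal{H})\cap\mathcal{H}_{\bar 0}$, $\mathfrak{B}_{\mathcal{H}}(\mathfrak{a}_0,\mathfrak{a}_0)=0$, and $\mathfrak{B}_{\mathcal{H}}(\delta(x),y)=(-1)^{|x|+|y|}\mathfrak{B}_{\mathcal{H}}(x,D(y))$ for all homogeneous $x,y\in\mathcal{H}$. The odd double extension of $\mathcal{H}$ by $\mathcal{N}$ by means of $(\delta,D,\mathfrak{a}_0)$ is $\overline{\mathcal{H}}=\mathcal{N}^*\oplus\mathcal{H}\oplus\mathcal{N}$, $\mathcal{N}^*=\mathbb{K}d^*$ ($d^*$ odd), with product $d\odot d=\mathfrak{a}_0$, $d\odot x=\delta(x)-\mathfrak{B}_{\mathcal{H}}(x,\mathfrak{a}_0)d^*$, $x\odot y=xy-\mathfrak{B}_{\mathcal{H}}(\delta(x),y)d^*$, $x\odot d=D(x)+\mathfrak{B}_{\mathcal{H}}(x,\mathfrak{a}_0)d^*$ for $x,y\in\mathcal{H}$ (all products involving $d^*$ zero), and with the form $\overline{\mathfrak{B}}$ extending $\mathfrak{B}_{\mathcal{H}}$ by $\overline{\mathfrak{B}}(d^*,d)=-\overline{\mathfrak{B}}(d,d^* )=1$ (other pairings of summands zero). "Isomorphic" means isomorphic as Zinbiel superalgebras.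
   Formalization: The field K is assumed to have characteristic different from 2; over GF(2) the claim fails, for example for a quadratic symmetric Zinbiel superalgebra of dimension (4,4) with nonzero triple products. *)

theory Defs
  imports Complex_Main "HOL-Library.Z2" "HOL-Library.Product_Plus"
begin

text \<open>
  A graded vector space is given by its homogeneous parts \<open>A 0\<close> and \<open>A 1\<close>, indexed by the
  two-element field \<open>bit\<close> and lying in an ambient vector space of arbitrary dimension.
  All operations matter only on the carrier \<open>A 0 + A 1\<close>; their values elsewhere are irrelevant.
\<close>

definition carrier :: "(bit \<Rightarrow> 'a::ab_group_add set) \<Rightarrow> 'a set" where
  "carrier A = {x + y | x y. x \<in> A 0 \<and> y \<in> A 1}"

text \<open>The sign \<open>(-1)\<^sup>i\<close> for a degree \<open>i\<close>, as a scalar.\<close>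

definition sign :: "bit \<Rightarrow> 'k::field" where
  "sign i = (if i = 0 then 1 else - 1)"

definition linear_between ::
  "('k::field \<Rightarrow> 'a::ab_group_add \<Rightarrow> 'a) \<Rightarrow> 'a set \<Rightarrow> ('k \<Rightarrow> 'b::ab_group_add \<Rightarrow> 'b) \<Rightarrow> 'b set
    \<Rightarrow> ('a \<Rightarrow> 'b) \<Rightarrow> bool" where
  "linear_between s V s' V' f \<longleftrightarrow>
     (\<forall>x\<in>V. f x \<in> V') \<and>
     (\<forall>x\<in>V. \<forall>y\<in>V. f (x + y) = f x + f y) \<and>
     (\<forall>c. \<forall>x\<in>V. f (s c x) = s' c (f x))"

definition superdim :: "('k::field \<Rightarrow> 'a::ab_group_add \<Rightarrow> 'a) \<Rightarrow> (bit \<Rightarrow> 'a set) \<Rightarrow> nat \<times> nat" where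
  "superdim s A = (vector_space.dim s (A 0), vector_space.dim s (A 1))"

definition annihilator ::
  "(bit \<Rightarrow> 'a::ab_group_add set) \<Rightarrow> ('a \<Rightarrow> 'a \<Rightarrow> 'a) \<Rightarrow> 'a set" where
  "annihilator A mult = {a \<in> carrier A. \<forall>x\<in>carrier A. mult a x = 0 \<and> mult x a = 0}"

definition square ::
  "('k::field \<Rightarrow> 'a::ab_group_add \<Rightarrow> 'a) \<Rightarrow> (bit \<Rightarrow> 'a set) \<Rightarrow> ('a \<Rightarrow> 'a \<Rightarrow> 'a) \<Rightarrow> 'a set" where
  "square s A mult = module.span s {mult x y | x y. x \<in> carrier A \<and> y \<in> carrier A}"

locale superalgebra = vector_space scale
  for scale :: "'k::field \<Rightarrow> 'a::ab_group_add \<Rightarrow> 'a" (infixr \<open>*s\<close> 75) +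
  fixes A :: "bit \<Rightarrow> 'a set"
    and mult :: "'a \<Rightarrow> 'a \<Rightarrow> 'a" (infixl \<open>\<odot>\<close> 76)
  assumes subspace_part: "subspace (A i)"
    and finite_dim_part: "\<exists>B. finite B \<and> A i \<subseteq> span B"
    and direct: "A 0 \<inter> A 1 = {0}"
    and mult_linear_right: "x \<in> carrier A \<Longrightarrow> linear_between scale (carrier A) scale (carrier A) (\<lambda>y. x \<odot> y)"
    and mult_linear_left: "y \<in> carrier A \<Longrightarrow> linear_between scale (carrier A) scale (carrier A) (\<lambda>x. x \<odot> y)"
    and mult_graded: "x \<in> A i \<Longrightarrow> y \<in> A j \<Longrightarrow> x \<odot> y \<in> A (i + j)"

locale left_zinbiel_superalgebra = superalgebra +
  assumes left_zinbiel: "x \<in> A i \<Longrightarrow> y \<in> A j \<Longrightarrow> z \<in> A k \<Longrightarrow>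
    (x \<odot> y) \<odot> z = x \<odot> (y \<odot> z) + sign (j * k) *s (x \<odot> (z \<odot> y))"

locale right_zinbiel_superalgebra = superalgebra +
  assumes right_zinbiel: "x \<in> A i \<Longrightarrow> y \<in> A j \<Longrightarrow> z \<in> A k \<Longrightarrow>
    x \<odot> (y \<odot> z) = (x \<odot> y) \<odot> z + sign (i * j) *s ((y \<odot> x) \<odot> z)"

locale symmetric_zinbiel_superalgebra = left_zinbiel_superalgebra + right_zinbiel_superalgebra

locale quadratic_zinbiel_superalgebra = superalgebra scale A mult
  for scale :: "'k::field \<Rightarrow> 'a::ab_group_add \<Rightarrow> 'a" (infixr \<open>*s\<close> 75)
    and A :: "bit \<Rightarrow> 'a set"
    and mult :: "'a \<Rightarrow> 'a \<Rightarrow> 'a" (infixl \<open>\<odot>\<close> 76) +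
  fixes form :: "'a \<Rightarrow> 'a \<Rightarrow> 'k"
  assumes left_or_right_zinbiel:
      "left_zinbiel_superalgebra scale A mult \<or> right_zinbiel_superalgebra scale A mult"
    and form_linear_right: "x \<in> carrier A \<Longrightarrow> linear_between scale (carrier A) (*) UNIV (\<lambda>y. form x y)"
    and form_linear_left: "y \<in> carrier A \<Longrightarrow> linear_between scale (carrier A) (*) UNIV (\<lambda>x. form x y)"
    and nondegenerate: "x \<in> carrier A \<Longrightarrow> (\<And>y. y \<in> carrier A \<Longrightarrow> form x y = 0) \<Longrightarrow> x = 0"
    and supersymmetric: "x \<in> A i \<Longrightarrow> y \<in> A j \<Longrightarrow> form x y = sign (i * j) * form y x"
    and invariant: "x \<in> carrier A \<Longrightarrow> y \<in> carrier A \<Longrightarrow> z \<in> carrier A \<Longrightarrow>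
      form (x \<odot> y) z = form x (y \<odot> z)"
    and even_form: "x \<in> A 0 \<Longrightarrow> y \<in> A 1 \<Longrightarrow> form x y = 0 \<and> form y x = 0"

text \<open>The parameter \<open>e\<close> below is the common degree \<open>|d|\<close> of \<open>\<delta>\<close> and \<open>D\<close>.\<close>

locale admissible_triple = symmetric_zinbiel_superalgebra scale A mult
  for scale :: "'k::field \<Rightarrow> 'a::ab_group_add \<Rightarrow> 'a" (infixr \<open>*s\<close> 75)
    and A :: "bit \<Rightarrow> 'a set"
    and mult :: "'a \<Rightarrow> 'a \<Rightarrow> 'a" (infixl \<open>\<odot>\<close> 76) +
  fixes e :: bit
    and \<delta> :: "'a \<Rightarrow> 'a"
    and D :: "'a \<Rightarrow> 'a"
    and a0 :: 'a
  assumes \<delta>_linear: "linear_between scale (carrier A) scale (carrier A) \<delta>"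
    and D_linear: "linear_between scale (carrier A) scale (carrier A) D"
    and \<delta>_degree: "x \<in> A i \<Longrightarrow> \<delta> x \<in> A (i + e)"
    and D_degree: "x \<in> A i \<Longrightarrow> D x \<in> A (i + e)"
    and a0_mem: "a0 \<in> annihilator A mult \<inter> A 0"
    and \<delta>_mult: "x \<in> A i \<Longrightarrow> y \<in> A j \<Longrightarrow>
        \<delta> (x \<odot> y) = sign (e * i) *s (x \<odot> \<delta> y) \<and>
        \<delta> (x \<odot> y) = \<delta> x \<odot> y + sign (e * i) *s (D x \<odot> y) \<and>
        \<delta> (x \<odot> y) = - (sign (j * (i + e)) *s (D y \<odot> x))"
    and mult_\<delta>: "x \<in> A i \<Longrightarrow> y \<in> A j \<Longrightarrow>
        \<delta> x \<odot> y = sign (i * j) *s (\<delta> y \<odot> x) \<and>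
        \<delta> x \<odot> y = - (sign (e * (i + j)) *s (x \<odot> D y))"
    and D_mult: "x \<in> A i \<Longrightarrow> y \<in> A j \<Longrightarrow> D (x \<odot> y) = sign (e * j) *s (D x \<odot> y)"
    and \<delta>_\<delta>: "x \<in> A i \<Longrightarrow>
        \<delta> (\<delta> x) = sign e *s \<delta> (\<delta> x) \<and>
        \<delta> (\<delta> x) = - D (D x) \<and>
        \<delta> (\<delta> x) = (1 + sign e) *s (a0 \<odot> x)"
    and \<delta>_D: "x \<in> A i \<Longrightarrow>
        \<delta> (D x) = - (sign e *s D (\<delta> x)) \<and>
        \<delta> (D x) = sign (e * i) *s (x \<odot> a0) \<and>
        \<delta> (D x) = - (sign (e * (i + e)) *s (a0 \<odot> x))"
    and \<delta>_a0: "\<delta> a0 = 0"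
    and D_a0: "D a0 = 0"

locale odd_double_extension_data =
  quadratic_zinbiel_superalgebra scale H mult form + admissible_triple scale H mult 1 \<delta> D a0
  for scale :: "'k::field \<Rightarrow> 'a::ab_group_add \<Rightarrow> 'a" (infixr \<open>*s\<close> 75)
    and H :: "bit \<Rightarrow> 'a set"
    and mult :: "'a \<Rightarrow> 'a \<Rightarrow> 'a" (infixl \<open>\<odot>\<close> 76)
    and form :: "'a \<Rightarrow> 'a \<Rightarrow> 'k"
    and \<delta> :: "'a \<Rightarrow> 'a"
    and D :: "'a \<Rightarrow> 'a"
    and a0 :: 'a +
  assumes \<delta>_annihilator: "\<delta> ` carrier H \<subseteq> annihilator H mult"
    and \<delta>_square: "\<delta> ` square scale H mult = {0}"
    and \<delta>_D_zero: "x \<in> carrier H \<Longrightarrow> \<delta> (D x) = 0"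
    and D_\<delta>_zero: "x \<in> carrier H \<Longrightarrow> D (\<delta> x) = 0"
    and form_a0: "form a0 a0 = 0"
    and form_\<delta>: "x \<in> H i \<Longrightarrow> y \<in> H j \<Longrightarrow> form (\<delta> x) y = sign (i + j) * form x (D y)"

text \<open>
  The odd double extension lives on \<open>\<K>d\<^sup>* \<oplus> H \<oplus> \<K>d\<close>, where the triple \<open>(p, x, q)\<close> stands for
  \<open>p d\<^sup>* + x + q d\<close> and both \<open>d\<close> and \<open>d\<^sup>*\<close> are odd. The formulas for the product and the form
  are the bilinear extensions of
  \<open>d \<odot> d = a\<^sub>0\<close>, \<open>d \<odot> x = \<delta>(x) - B(x, a\<^sub>0) d\<^sup>*\<close>, \<open>x \<odot> y = xy - B(\<delta>(x), y) d\<^sup>*\<close>,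
  \<open>x \<odot> d = D(x) + B(x, a\<^sub>0) d\<^sup>*\<close>, and of \<open>B(d\<^sup>*, d) = - B(d, d\<^sup>*) = 1\<close>.
\<close>

definition dext_scale ::
  "('k::field \<Rightarrow> 'a::ab_group_add \<Rightarrow> 'a) \<Rightarrow> 'k \<Rightarrow> 'k \<times> 'a \<times> 'k \<Rightarrow> 'k \<times> 'a \<times> 'k" where
  "dext_scale s c = (\<lambda>(p, x, q). (c * p, s c x, c * q))"

definition dext_part :: "(bit \<Rightarrow> 'a::ab_group_add set) \<Rightarrow> bit \<Rightarrow> ('k::field \<times> 'a \<times> 'k) set" where
  "dext_part H i = (if i = 0 then {0} \<times> H 0 \<times> {0} else UNIV \<times> H 1 \<times> UNIV)"

definition dext_mult ::
  "('k::field \<Rightarrow> 'a::ab_group_add \<Rightarrow> 'a) \<Rightarrow> ('a \<Rightarrow> 'a \<Rightarrow> 'a) \<Rightarrow> ('a \<Rightarrow> 'a \<Rightarrow> 'k)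
    \<Rightarrow> ('a \<Rightarrow> 'a) \<Rightarrow> ('a \<Rightarrow> 'a) \<Rightarrow> 'a \<Rightarrow> 'k \<times> 'a \<times> 'k \<Rightarrow> 'k \<times> 'a \<times> 'k \<Rightarrow> 'k \<times> 'a \<times> 'k" where
  "dext_mult s mult form \<delta> D a0 = (\<lambda>(p, x, q) (p', y, q').
     (- form (\<delta> x) y - q * form y a0 + q' * form x a0,
      mult x y + s q (\<delta> y) + s q' (D x) + s (q * q') a0,
      0))"

definition dext_form ::
  "('a::ab_group_add \<Rightarrow> 'a \<Rightarrow> 'k::field) \<Rightarrow> 'k \<times> 'a \<times> 'k \<Rightarrow> 'k \<times> 'a \<times> 'k \<Rightarrow> 'k" where
  "dext_form form = (\<lambda>(p, x, q) (p', y, q'). form x y + p * q' - q * p')"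

definition superalgebra_isomorphic ::
  "('k::field \<Rightarrow> 'a::ab_group_add \<Rightarrow> 'a) \<Rightarrow> (bit \<Rightarrow> 'a set) \<Rightarrow> ('a \<Rightarrow> 'a \<Rightarrow> 'a)
    \<Rightarrow> ('k \<Rightarrow> 'b::ab_group_add \<Rightarrow> 'b) \<Rightarrow> (bit \<Rightarrow> 'b set) \<Rightarrow> ('b \<Rightarrow> 'b \<Rightarrow> 'b) \<Rightarrow> bool" where
  "superalgebra_isomorphic s A mult s' A' mult' \<longleftrightarrow>
     (\<exists>f. bij_betw f (carrier A) (carrier A') \<and>
          linear_between s (carrier A) s' (carrier A') f \<and>
          (\<forall>i. f ` A i = A' i) \<and>
          (\<forall>x\<in>carrier A. \<forall>y\<in>carrier A. f (mult x y) = mult' (f x) (f y)))"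

end

theory Submission
  imports Defs
begin

text \<open>
  In a quadratic Zinbiel superalgebra over a field of characteristic not \<open>2\<close> all products of three
  elements vanish: with \<open>F x y z w = B(x(yz), w)\<close>, the two Zinbiel identities make \<open>F\<close>
  supersymmetric in \<open>x, y\<close> and super-antisymmetric in \<open>z, w\<close>, while invariance exchanges the
  pairs \<open>(x, y)\<close> and \<open>(z, w)\<close>; hence \<open>F = - F\<close>. Choose an odd annihilator element \<open>u\<close> and an odd
  \<open>d\<close> with \<open>B(u, d) = 1\<close>. Then \<open>A = \<K>u \<oplus> H \<oplus> \<K>d\<close> where \<open>H\<close> is the orthogonal
  of \<open>{u, d}\<close>. With \<open>\<pi>\<close> the projection onto \<open>H\<close>, the required data are
  \<open>\<pi>(xy)\<close>, \<open>\<delta> x = \<pi>(dx)\<close>, \<open>D x = \<pi>(xd)\<close> and \<open>a\<^sub>0 = dd\<close>. As \<open>\<pi>\<close> changes a product only by a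
  multiple of the annihilator element \<open>u\<close>, every term of the admissibility conditions is zero.
\<close>

lemma sign_simps [simp]: "sign 0 = 1" "sign 1 = - 1"
  by (simp_all add: sign_def)

section \<open>Closure and bilinearity on the carrier\<close>

context superalgebra
begin

lemma subspace_carrier: "subspace (carrier A)"
  unfolding carrier_def by (intro subspace_sums subspace_part)

lemma carrier_closed [simp, intro]:
  "0 \<in> carrier A"
  "x \<in> carrier A \<Longrightarrow> y \<in> carrier A \<Longrightarrow> x + y \<in> carrier A"
  "x \<in> carrier A \<Longrightarrow> y \<in> carrier A \<Longrightarrow> x - y \<in> carrier A"
  "x \<in> carrier A \<Longrightarrow> - x \<in> carrier A"
  "x \<in> carrier A \<Longrightarrow> c *s x \<in> carrier A"
  using subspace_carrier
  by (auto intro: subspace_0 subspace_add subspace_diff subspace_neg subspace_scale)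

lemma part_subset_carrier [intro]: "x \<in> A i \<Longrightarrow> x \<in> carrier A"
  using subspace_0[OF subspace_part[of 0]] subspace_0[OF subspace_part[of 1]]
  by (cases i) (force simp: carrier_def)+

lemma carrierE:
  assumes "x \<in> carrier A"
  obtains y z where "y \<in> A 0" "z \<in> A 1" "x = y + z"
  using assms by (auto simp: carrier_def)

lemma mult_carrier [simp, intro]: "x \<in> carrier A \<Longrightarrow> y \<in> carrier A \<Longrightarrow> x \<odot> y \<in> carrier A"
  using mult_linear_right by (auto simp: linear_between_def)

lemma mult_add [simp]:
  "x \<in> carrier A \<Longrightarrow> y \<in> carrier A \<Longrightarrow> z \<in> carrier A \<Longrightarrow> x \<odot> (y + z) = x \<odot> y + x \<odot> z"
  "x \<in> carrier A \<Longrightarrow> y \<in> carrier A \<Longrightarrow> z \<in> carrier A \<Longrightarrow> (y + z) \<odot> x = y \<odot> x + z \<odot> x"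
  using mult_linear_right mult_linear_left by (auto simp: linear_between_def)

lemma mult_scale [simp]:
  "x \<in> carrier A \<Longrightarrow> y \<in> carrier A \<Longrightarrow> x \<odot> (c *s y) = c *s (x \<odot> y)"
  "x \<in> carrier A \<Longrightarrow> y \<in> carrier A \<Longrightarrow> (c *s y) \<odot> x = c *s (y \<odot> x)"
  using mult_linear_right mult_linear_left by (auto simp: linear_between_def)

lemma mult_zero [simp]:
  "x \<in> carrier A \<Longrightarrow> x \<odot> 0 = 0"
  "x \<in> carrier A \<Longrightarrow> 0 \<odot> x = 0"
  using mult_scale[of x 0 0] by simp_all

end

section \<open>The invariant form and the vanishing of triple products\<close>

context quadratic_zinbiel_superalgebra
begin

lemma form_add [simp]:
  "x \<in> carrier A \<Longrightarrow> y \<in> carrier A \<Longrightarrow> z \<in> carrier A \<Longrightarrow> form x (y + z) = form x y + form x z"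
  "x \<in> carrier A \<Longrightarrow> y \<in> carrier A \<Longrightarrow> z \<in> carrier A \<Longrightarrow> form (y + z) x = form y x + form z x"
  using form_linear_right form_linear_left by (auto simp: linear_between_def)

lemma form_scale [simp]:
  "x \<in> carrier A \<Longrightarrow> y \<in> carrier A \<Longrightarrow> form x (c *s y) = c * form x y"
  "x \<in> carrier A \<Longrightarrow> y \<in> carrier A \<Longrightarrow> form (c *s y) x = c * form y x"
  using form_linear_right form_linear_left by (auto simp: linear_between_def)

lemma form_zero [simp]:
  "x \<in> carrier A \<Longrightarrow> form x 0 = 0"
  "x \<in> carrier A \<Longrightarrow> form 0 x = 0"
  using form_scale[of x 0 0] by simp_all

lemma form_diff [simp]:
  assumes "x \<in> carrier A" "y \<in> carrier A" "z \<in> carrier A"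
  shows "form x (y - z) = form x y - form x z" "form (y - z) x = form y x - form z x"
  using form_add[of x "y - z" z] assms by (simp_all add: eq_diff_eq)

lemma nondegenerateI:
  assumes "x \<in> carrier A" "\<And>i y. y \<in> A i \<Longrightarrow> form x y = 0"
  shows "x = 0"
proof (rule nondegenerate[OF assms(1)])
  fix y assume "y \<in> carrier A"
  then obtain y0 y1 where "y0 \<in> A 0" "y1 \<in> A 1" "y = y0 + y1" by (rule carrierE)
  then show "form x y = 0"
    using assms part_subset_carrier by simp
qed

text \<open>Supersymmetry carries \<open>x\<close> past the whole product to the front of the form;
  invariance, applied twice, then rebrackets.\<close>

lemma form_rotate:
  assumes "x \<in> A i" "y \<in> A j" "z \<in> A k" "w \<in> A l"
  shows "form (y \<odot> (z \<odot> w)) x = sign (i * (j + k + l)) * form ((x \<odot> y) \<odot> z) w"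
proof -
  have c: "x \<in> carrier A" "y \<in> carrier A" "z \<in> carrier A" "w \<in> carrier A"
    using assms by auto
  have "form (y \<odot> (z \<odot> w)) x = sign ((j + (k + l)) * i) * form x (y \<odot> (z \<odot> w))"
    by (intro supersymmetric assms mult_graded)
  also have "form x (y \<odot> (z \<odot> w)) = form ((x \<odot> y) \<odot> z) w"
    using c by (simp add: invariant)
  finally show ?thesis by (simp only: add.assoc mult.commute)
qed

text \<open>Invariance turns either Zinbiel identity into the other, seen through the form.\<close>

lemma form_left_zinbiel:
  assumes h: "x \<in> A i" "y \<in> A j" "z \<in> A k" "w \<in> A l"
  shows "form ((x \<odot> y) \<odot> z) w = form (x \<odot> (y \<odot> z)) w + sign (j * k) * form (x \<odot> (z \<odot> y)) w"
proof -
  have c: "x \<in> carrier A" "y \<in> carrier A" "z \<in> carrier A" "w \<in> carrier A"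
    using h by auto
  from left_or_right_zinbiel show ?thesis
  proof
    assume "left_zinbiel_superalgebra scale A mult"
    then interpret left_zinbiel_superalgebra scale A mult .
    show ?thesis using c by (simp add: left_zinbiel[OF h(1-3)])
  next
    assume "right_zinbiel_superalgebra scale A mult"
    then interpret right_zinbiel_superalgebra scale A mult .
    show ?thesis using c by (simp add: invariant right_zinbiel[OF h(2-4)])
  qed
qed

lemma form_right_zinbiel:
  assumes h: "x \<in> A i" "y \<in> A j" "z \<in> A k" "w \<in> A l"
  shows "form (x \<odot> (y \<odot> z)) w = form ((x \<odot> y) \<odot> z) w + sign (i * j) * form ((y \<odot> x) \<odot> z) w"
proof -
  have c: "x \<in> carrier A" "y \<in> carrier A" "z \<in> carrier A" "w \<in> carrier A"
    using h by auto
  from left_or_right_zinbiel show ?thesis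
  proof
    assume "right_zinbiel_superalgebra scale A mult"
    then interpret right_zinbiel_superalgebra scale A mult .
    show ?thesis using c by (simp add: right_zinbiel[OF h(1-3)])
  next
    assume "left_zinbiel_superalgebra scale A mult"
    then interpret left_zinbiel_superalgebra scale A mult .
    \<comment> \<open>The left identity for \<open>w, x, y\<close>, paired with \<open>z\<close>,
      becomes the right identity for \<open>x, y, z\<close> in the second argument of the
      form.\<close>
    have "form (w \<odot> x) (y \<odot> z) = form ((w \<odot> x) \<odot> y) z"
      using c by (simp add: invariant)
    also have "\<dots> = form (w \<odot> (x \<odot> y)) z + sign (i * j) * form (w \<odot> (y \<odot> x)) z"
      using c by (simp add: left_zinbiel[OF h(4,1,2)])
    finally have *: "form w (x \<odot> (y \<odot> z)) = form w ((x \<odot> y) \<odot> z) + sign (i * j) * form w ((y \<odot> x) \<odot> z)"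
      using c by (simp add: invariant)
    \<comment> \<open>All three products have degree \<open>i + j + k\<close>, so moving
      \<open>w\<close> to the last slot costs the same sign in each term.\<close>
    have "form (x \<odot> (y \<odot> z)) w = sign ((i + (j + k)) * l) * form w (x \<odot> (y \<odot> z))"
      "form ((x \<odot> y) \<odot> z) w = sign ((i + j + k) * l) * form w ((x \<odot> y) \<odot> z)"
      "form ((y \<odot> x) \<odot> z) w = sign ((j + i + k) * l) * form w ((y \<odot> x) \<odot> z)"
      by (intro supersymmetric h mult_graded)+
    with * show ?thesis by (simp add: algebra_simps)
  qed
qed

lemma form_triple_zero:
  assumes char: "(2::'k) \<noteq> 0"
    and h: "x \<in> A i" "y \<in> A j" "z \<in> A k" "w \<in> A l"
  shows "form (x \<odot> (y \<odot> z)) w = 0"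
proof -
  let ?F = "\<lambda>x y z w. form (x \<odot> (y \<odot> z)) w"
  \<comment> \<open>The left identity makes \<open>(x y) z\<close> supersymmetric in
    \<open>y, z\<close>; rotation transfers this to the first two arguments of
    \<open>?F\<close>.\<close>
  have symmetric: "?F y z w x = sign (j * k) * ?F z y w x"
    if "x \<in> A i" "y \<in> A j" "z \<in> A k" "w \<in> A l" for x y z w i j k l
    unfolding form_rotate[OF that] form_rotate[OF that(1,3,2,4)]
      form_left_zinbiel[OF that] form_left_zinbiel[OF that(1,3,2,4)]
    by (cases i; cases j; cases k; cases l) simp_all
  \<comment> \<open>Combining the two identities cancels the \<open>x (y z)\<close> terms, so
    \<open>(y x) z\<close> is minus \<open>x (z y)\<close> up to the Koszul sign; rotating
    \<open>y\<close> to the back gives the claim.\<close>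
  have antisymmetric: "?F x z y w = - (sign (j * l) * ?F x z w y)"
    if "x \<in> A i" "y \<in> A j" "z \<in> A k" "w \<in> A l" for x y z w i j k l
  proof -
    have "form ((y \<odot> x) \<odot> z) w = sign (i * j) * (?F x y z w - form ((x \<odot> y) \<odot> z) w)"
      unfolding form_right_zinbiel[OF that] by (cases i; cases j) simp_all
    then show ?thesis
      unfolding form_rotate[OF that(2,1,3,4)] form_left_zinbiel[OF that]
      by (cases i; cases j; cases k; cases l) simp_all
  qed
  have exchange: "?F x y z w = sign ((i + j) * (k + l)) * ?F z w x y"
    if "x \<in> A i" "y \<in> A j" "z \<in> A k" "w \<in> A l" for x y z w i j k l
  proof -
    have "?F x y z w = form x ((y \<odot> z) \<odot> w)"
      using that by (simp add: invariant part_subset_carrier)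
    also have "\<dots> = sign (i * (j + k + l)) * form ((y \<odot> z) \<odot> w) x"
      by (intro supersymmetric that mult_graded)
    also have "\<dots> = sign ((i + j) * (k + l)) * ?F z w x y"
      unfolding form_rotate[OF that(2-4,1)]
      by (cases i; cases j; cases k; cases l) simp_all
    finally show ?thesis .
  qed
  \<comment> \<open>Swap the pairs, exchange \<open>z\<close> and \<open>w\<close> in the symmetric
    slots, swap the pairs back, and exchange again in the antisymmetric slots: only a minus sign
    survives.\<close>
  have "?F x y z w = sign ((i + j) * (k + l)) * (sign (k * l) * ?F w z x y)"
    by (simp only: exchange[OF h] symmetric[OF h(2,3,4,1)])
  also have "\<dots> = sign (k * l) * ?F x y w z"
    unfolding exchange[OF h(1,2,4,3)] by (simp only: ac_simps)
  also have "\<dots> = - ?F x y z w"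
    unfolding antisymmetric[OF h(1,3,2,4)] by simp
  finally have "?F x y z w = - ?F x y z w" .
  then have "2 * ?F x y z w = 0"
    by (simp add: eq_neg_iff_add_eq_0)
  with char show ?thesis by simp
qed

text \<open>Nondegeneracy removes the test vector \<open>w\<close>, the left identity under the form
  covers the other bracketing, and bilinearity passes from homogeneous to arbitrary factors.\<close>

lemma triple_zero:
  assumes char: "(2::'k) \<noteq> 0" and "x \<in> carrier A" "y \<in> carrier A" "z \<in> carrier A"
  shows "x \<odot> (y \<odot> z) = 0" "(x \<odot> y) \<odot> z = 0"
proof -
  have hom: "x \<odot> (y \<odot> z) = 0" "(x \<odot> y) \<odot> z = 0"
    if h: "x \<in> A i" "y \<in> A j" "z \<in> A k" for x y z i j k
    using h by (auto intro!: nondegenerateI simp: form_left_zinbiel form_triple_zero[OF char])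
  from assms obtain x0 x1 y0 y1 z0 z1 where
    "x0 \<in> A 0" "x1 \<in> A 1" "x = x0 + x1" "y0 \<in> A 0" "y1 \<in> A 1" "y = y0 + y1"
    "z0 \<in> A 0" "z1 \<in> A 1" "z = z0 + z1"
    by (meson carrierE)
  then show "x \<odot> (y \<odot> z) = 0" "(x \<odot> y) \<odot> z = 0"
    using hom part_subset_carrier by simp_all
qed

end

section \<open>An odd hyperbolic pair and the projection onto its orthogonal complement\<close>

text \<open>The element \<open>u\<close> plays the role of \<open>d\<^sup>*\<close>.\<close>

locale odd_hyperbolic_pair = quadratic_zinbiel_superalgebra scale A mult form
  for scale :: "'k::field \<Rightarrow> 'a::ab_group_add \<Rightarrow> 'a" (infixr \<open>*s\<close> 75)
    and A :: "bit \<Rightarrow> 'a set"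
    and mult :: "'a \<Rightarrow> 'a \<Rightarrow> 'a" (infixl \<open>\<odot>\<close> 76)
    and form :: "'a \<Rightarrow> 'a \<Rightarrow> 'k" +
  fixes u d :: 'a
  assumes char_not_2: "(2::'k) \<noteq> 0"
    and u_annihilator: "u \<in> annihilator A mult"
    and u_odd: "u \<in> A 1"
    and d_odd: "d \<in> A 1"
    and form_u_d [simp]: "form u d = 1"
begin

text \<open>The \<open>d\<close>-coordinate of \<open>x\<close> is \<open>form u x\<close>, but the
  \<open>u\<close>-coordinate is \<open>- form d x\<close> because \<open>form d u = - 1\<close>;
  hence the plus sign.\<close>

definition proj :: "'a \<Rightarrow> 'a" where
  "proj x = x - form u x *s d + form d x *s u"

definition H :: "bit \<Rightarrow> 'a set" where
  "H i = {x \<in> A i. form u x = 0 \<and> form d x = 0}"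

definition mult_H :: "'a \<Rightarrow> 'a \<Rightarrow> 'a" where
  "mult_H x y = proj (x \<odot> y)"

definition left_d :: "'a \<Rightarrow> 'a" where
  "left_d x = proj (d \<odot> x)"

definition right_d :: "'a \<Rightarrow> 'a" where
  "right_d x = proj (x \<odot> d)"

lemma ud_carrier [simp]: "u \<in> carrier A" "d \<in> carrier A"
  using u_odd d_odd by auto

lemma u_mult [simp]: "x \<in> carrier A \<Longrightarrow> u \<odot> x = 0" "x \<in> carrier A \<Longrightarrow> x \<odot> u = 0"
  using u_annihilator by (auto simp: annihilator_def)

text \<open>On the odd part supersymmetry is antisymmetry, which makes the form alternating in
  characteristic other than 2.\<close>

lemma form_odd_self:
  assumes "x \<in> A 1"
  shows "form x x = 0"
proof -
  have "form x x = - form x x"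
    using supersymmetric[OF assms assms] by simp
  then have "2 * form x x = 0"
    by (simp add: eq_neg_iff_add_eq_0)
  with char_not_2 show ?thesis by simp
qed

lemma form_ud [simp]: "form u u = 0" "form d d = 0" "form d u = - 1"
  using form_odd_self u_odd d_odd supersymmetric[of d 1 u 1] by simp_all

lemma form_ud_even [simp]:
  "x \<in> A 0 \<Longrightarrow> form u x = 0" "x \<in> A 0 \<Longrightarrow> form d x = 0"
  "x \<in> A 0 \<Longrightarrow> form x u = 0" "x \<in> A 0 \<Longrightarrow> form x d = 0"
  using even_form u_odd d_odd by auto

text \<open>Even components pair to zero with the odd \<open>u\<close> and \<open>d\<close>, so the
  odd sign rule extends to mixed elements.\<close>

lemma form_ud_commute:
  assumes "x \<in> carrier A"
  shows "form x u = - form u x" "form x d = - form d x"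
proof -
  obtain y z where "y \<in> A 0" "z \<in> A 1" "x = y + z"
    using assms by (rule carrierE)
  then show "form x u = - form u x" "form x d = - form d x"
    using u_odd d_odd supersymmetric[of z 1 u 1] supersymmetric[of z 1 d 1]
    by (simp_all add: part_subset_carrier)
qed

text \<open>Since \<open>u\<close> annihilates \<open>x\<close>, no product has a
  \<open>d\<close>-component, so \<open>proj\<close> alters products only along
  \<open>u\<close>.\<close>

lemma form_u_mult [simp]: "x \<in> carrier A \<Longrightarrow> y \<in> carrier A \<Longrightarrow> form u (x \<odot> y) = 0"
  by (simp flip: invariant)

lemma triple_zero' [simp]:
  assumes "x \<in> carrier A" "y \<in> carrier A" "z \<in> carrier A"
  shows "x \<odot> (y \<odot> z) = 0" "(x \<odot> y) \<odot> z = 0"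
  using triple_zero[OF char_not_2 assms] by simp_all

lemma H_even [simp]: "H 0 = A 0"
  by (auto simp: H_def)

lemma H_subset: "x \<in> H i \<Longrightarrow> x \<in> A i"
  by (simp add: H_def)

lemma carrier_H: "carrier H = {x \<in> carrier A. form u x = 0 \<and> form d x = 0}"
proof (intro subset_antisym subsetI)
  fix x assume "x \<in> carrier H"
  then obtain y z where "y \<in> A 0" "z \<in> H 1" "x = y + z"
    by (auto simp: carrier_def)
  then show "x \<in> {x \<in> carrier A. form u x = 0 \<and> form d x = 0}"
    by (auto simp: H_def part_subset_carrier)
next
  fix x assume x: "x \<in> {x \<in> carrier A. form u x = 0 \<and> form d x = 0}"
  then obtain y z where yz: "y \<in> A 0" "z \<in> A 1" and x_eq: "x = y + z"
    using carrierE by blast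
  have "z \<in> H 1"
    using x yz by (simp add: x_eq H_def part_subset_carrier)
  then show "x \<in> carrier H"
    unfolding carrier_def x_eq using yz H_even by blast
qed

lemma proj_carrier_H [simp]: "x \<in> carrier A \<Longrightarrow> proj x \<in> carrier H"
  by (simp add: carrier_H proj_def)

lemma proj_zero [simp]: "proj 0 = 0"
  by (simp add: proj_def)

lemma proj_H: "x \<in> carrier H \<Longrightarrow> proj x = x"
  by (simp add: carrier_H proj_def)

lemma proj_part:
  assumes "x \<in> A i"
  shows "proj x \<in> H i"
proof (cases i)
  case zero
  with assms show ?thesis by (simp add: proj_def)
next
  case one
  with assms u_odd d_odd have "proj x \<in> A 1"
    by (simp add: proj_def subspace_part subspace_add subspace_diff subspace_scale)
  moreover have "proj x \<in> carrier H"
    using assms by (simp add: part_subset_carrier)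
  ultimately show ?thesis
    using one by (simp add: H_def carrier_H)
qed

lemma proj_add:
  "x \<in> carrier A \<Longrightarrow> y \<in> carrier A \<Longrightarrow> proj (x + y) = proj x + proj y"
  by (simp add: proj_def algebra_simps)

lemma proj_scale: "x \<in> carrier A \<Longrightarrow> proj (c *s x) = c *s proj x"
  by (simp add: proj_def algebra_simps)

text \<open>The correction terms are multiples of \<open>u\<close> and \<open>d\<close>, both
  orthogonal to \<open>H\<close>.\<close>

lemma form_proj:
  assumes "x \<in> carrier A" "y \<in> carrier H"
  shows "form (proj x) y = form x y" "form y (proj x) = form y x"
  using assms form_ud_commute[of y] by (simp_all add: proj_def carrier_H)

text \<open>Projecting the inner product only adds a multiple of the annihilator element
  \<open>u\<close>, so nested products still vanish.\<close>

lemma mult_proj_mult [simp]: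
  assumes "x \<in> carrier A" "y \<in> carrier A" "z \<in> carrier A"
  shows "z \<odot> proj (x \<odot> y) = 0" "proj (x \<odot> y) \<odot> z = 0"
  using assms by (simp_all add: proj_def)

lemma H_part_carrier: "x \<in> H i \<Longrightarrow> x \<in> carrier H"
  by (auto simp: H_def carrier_H)

lemma H_carrier [simp]: "x \<in> carrier H \<Longrightarrow> x \<in> carrier A"
  by (simp add: carrier_H)

section \<open>The complement as a quadratic Zinbiel superalgebra\<close>

lemma subspace_H: "subspace (H i)"
  using subspace_part[of i]
  by (auto simp: H_def subspace_def part_subset_carrier)

sublocale H: superalgebra scale H mult_H
proof
  show "\<exists>B. finite B \<and> H i \<subseteq> span B" for i
    using finite_dim_part[of i] H_subset by blast
  show "H 0 \<inter> H 1 = {0}"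
    using direct subspace_0[OF subspace_H, of 1] by (auto simp: H_def)
  show "linear_between scale (carrier H) scale (carrier H) (mult_H x)" if "x \<in> carrier H" for x
    using that by (simp add: linear_between_def mult_H_def proj_add proj_scale)
  show "linear_between scale (carrier H) scale (carrier H) (\<lambda>x. mult_H x y)" if "y \<in> carrier H" for y
    using that by (simp add: linear_between_def mult_H_def proj_add proj_scale)
  show "mult_H x y \<in> H (i + j)" if "x \<in> H i" "y \<in> H j" for x y i j
    unfolding mult_H_def using that by (intro proj_part mult_graded H_subset)
qed (rule subspace_H)

lemma mult_H_mult_H:
  assumes "x \<in> carrier H" "y \<in> carrier H" "z \<in> carrier H"
  shows "mult_H x (mult_H y z) = 0" "mult_H (mult_H x y) z = 0"
  using assms by (simp_all add: mult_H_def)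

sublocale H: symmetric_zinbiel_superalgebra scale H mult_H
  by unfold_locales (simp_all add: mult_H_mult_H H_part_carrier)

sublocale H: quadratic_zinbiel_superalgebra scale H mult_H form
proof
  show "left_zinbiel_superalgebra scale H mult_H \<or> right_zinbiel_superalgebra scale H mult_H"
    using H.left_zinbiel_superalgebra_axioms by blast
  show "linear_between scale (carrier H) (*) UNIV (form x)" if "x \<in> carrier H" for x
    using that by (simp add: linear_between_def)
  show "linear_between scale (carrier H) (*) UNIV (\<lambda>x. form x y)" if "y \<in> carrier H" for y
    using that by (simp add: linear_between_def)
  \<comment> \<open>A vector of \<open>H\<close> pairs with \<open>y\<close> as it does with
    \<open>proj y\<close>, so orthogonality to \<open>H\<close> implies orthogonality to all of
    \<open>A\<close>.\<close>
  show "x = 0" if x: "x \<in> carrier H" "\<And>y. y \<in> carrier H \<Longrightarrow> form x y = 0" for x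
  proof (rule nondegenerate)
    fix y assume "y \<in> carrier A"
    with x show "form x y = 0"
      using form_proj(2)[of y x] by simp
  qed (use x in simp)
  show "form x y = sign (i * j) * form y x" if "x \<in> H i" "y \<in> H j" for x y i j
    using that by (intro supersymmetric H_subset)
  show "form (mult_H x y) z = form x (mult_H y z)"
    if "x \<in> carrier H" "y \<in> carrier H" "z \<in> carrier H" for x y z
    using that by (simp add: mult_H_def form_proj invariant)
  show "form x y = 0 \<and> form y x = 0" if "x \<in> H 0" "y \<in> H 1" for x y
    using that by (intro even_form H_subset)
qed

section \<open>The admissible triple and the extension data\<close>

lemma proj_mult_annihilator:
  "x \<in> carrier A \<Longrightarrow> y \<in> carrier A \<Longrightarrow> proj (x \<odot> y) \<in> annihilator H mult_H"
  by (simp add: annihilator_def mult_H_def)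

lemma dd_even: "d \<odot> d \<in> A 0"
  using mult_graded[OF d_odd d_odd] by simp

lemma dd_carrier_H: "d \<odot> d \<in> carrier H"
  using dd_even by (intro H_part_carrier[of _ 0]) simp

lemma left_d_linear: "linear_between scale (carrier H) scale (carrier H) left_d"
  by (simp add: linear_between_def left_d_def proj_add proj_scale)

lemma right_d_linear: "linear_between scale (carrier H) scale (carrier H) right_d"
  by (simp add: linear_between_def right_d_def proj_add proj_scale)

text \<open>The identities involve only nested products and simplify to \<open>0 = 0\<close>; the
  two degree shifts come from \<open>d\<close> being odd.\<close>

sublocale H: admissible_triple scale H mult_H 1 left_d right_d "d \<odot> d"
proof
  show "d \<odot> d \<in> annihilator H mult_H \<inter> H 0"
    using proj_mult_annihilator[of d d] dd_even by (simp add: proj_H dd_carrier_H)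
  show "left_d x \<in> H (i + 1)" if "x \<in> H i" for x i
    using mult_graded[OF d_odd H_subset[OF that]] by (simp add: left_d_def proj_part add.commute)
  show "right_d x \<in> H (i + 1)" if "x \<in> H i" for x i
    using mult_graded[OF H_subset[OF that] d_odd] by (simp add: right_d_def proj_part)
qed (simp_all add: left_d_linear right_d_linear left_d_def right_d_def mult_H_def H_part_carrier)

lemma left_d_square: "left_d ` square scale H mult_H = {0}"
proof -
  let ?K = "{x \<in> carrier H. left_d x = 0}"
  have "subspace ?K"
    using left_d_linear by (auto simp: subspace_def linear_between_def left_d_def)
  then have "square scale H mult_H \<subseteq> ?K"
    unfolding square_def by (intro span_minimal) (auto simp: left_d_def mult_H_def)
  \<comment> \<open>Equality with \<open>{0}\<close> also requires the image to be nonempty.\<close>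
  moreover have "0 \<in> square scale H mult_H"
    by (simp add: square_def span_zero)
  ultimately show ?thesis
    by (auto simp: image_iff intro!: bexI[of _ 0])
qed

sublocale H: odd_double_extension_data scale H mult_H form left_d right_d "d \<odot> d"
proof
  show "left_d ` carrier H \<subseteq> annihilator H mult_H"
    by (auto simp: left_d_def intro: proj_mult_annihilator)
  show "left_d ` square scale H mult_H = {0}"
    by (rule left_d_square)
  show "left_d (right_d x) = 0" "right_d (left_d x) = 0" if "x \<in> carrier H" for x
    using that by (simp_all add: left_d_def right_d_def)
  \<comment> \<open>Invariance exposes the triple product \<open>d (d d)\<close>.\<close>
  show "form (d \<odot> d) (d \<odot> d) = 0"
    by (simp add: invariant)
  show "form (left_d x) y = sign (i + j) * form x (right_d y)"
    if "x \<in> H i" "y \<in> H j" for x y i j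
  proof -
    have c: "x \<in> carrier H" "y \<in> carrier H" using that by (auto intro: H_part_carrier)
    have "form (left_d x) y = form d (x \<odot> y)"
      using c by (simp add: left_d_def form_proj invariant)
    \<comment> \<open>The sign arises from moving the odd \<open>d\<close> past a product of degree
      \<open>i + j\<close>.\<close>
    also have "\<dots> = sign (1 * (i + j)) * form (x \<odot> y) d"
      using that by (intro supersymmetric d_odd mult_graded H_subset)
    also have "form (x \<odot> y) d = form x (right_d y)"
      using c by (simp add: right_d_def form_proj invariant)
    finally show ?thesis by simp
  qed
qed

section \<open>The isomorphism with the double extension\<close>

definition split :: "'a \<Rightarrow> 'k \<times> 'a \<times> 'k" where
  "split x = (- form d x, proj x, form u x)"

definition unsplit :: "'k \<times> 'a \<times> 'k \<Rightarrow> 'a" where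
  "unsplit = (\<lambda>(p, x, q). p *s u + x + q *s d)"

lemma unsplit_split: "unsplit (split x) = x"
  by (simp add: unsplit_def split_def proj_def)

lemma split_unsplit: "x \<in> carrier H \<Longrightarrow> split (unsplit (p, x, q)) = (p, x, q)"
  by (simp add: unsplit_def split_def proj_def carrier_H algebra_simps del: H_carrier)

lemma split_image: "split ` A i = dext_part H i"
proof (intro subset_antisym subsetI)
  fix t assume "t \<in> split ` A i"
  then show "t \<in> dext_part H i"
    using proj_part[of _ i] by (cases i) (auto simp: split_def dext_part_def)
next
  fix t :: "'k \<times> 'a \<times> 'k" assume t: "t \<in> dext_part H i"
  then obtain p x q where [simp]: "t = (p, x, q)" and x: "x \<in> H i"
    by (cases t) (auto simp: dext_part_def split: if_splits)
  have "unsplit t \<in> A i"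
    using t x u_odd d_odd H_subset[OF x] subspace_part[of i]
    by (cases i) (auto simp: unsplit_def dext_part_def intro: subspace_add subspace_scale)
  moreover have "t = split (unsplit t)"
    using x by (simp add: split_unsplit H_part_carrier)
  ultimately show "t \<in> split ` A i" by blast
qed

lemma split_add: "x \<in> carrier A \<Longrightarrow> y \<in> carrier A \<Longrightarrow> split (x + y) = split x + split y"
  by (simp add: split_def proj_add)

lemma split_carrier: "split ` carrier A = carrier (dext_part H)"
proof -
  have "split ` carrier A = {split x + split y | x y. x \<in> A 0 \<and> y \<in> A 1}"
    by (auto simp: carrier_def[of A] image_iff split_add part_subset_carrier)
      (metis split_add part_subset_carrier)+
  also have "\<dots> = carrier (dext_part H)"
    unfolding carrier_def split_image[symmetric] by blast
  finally show ?thesis .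
qed

text \<open>The third coordinate vanishes by \<open>form_u_mult\<close>, the middle one is the
  projected product, and the first is \<open>- form d (x y)\<close> rewritten by invariance.\<close>

lemma split_mult:
  assumes "x \<in> carrier A" "y \<in> carrier A"
  shows "split (x \<odot> y) = dext_mult scale mult_H form left_d right_d (d \<odot> d) (split x) (split y)"
proof -
  have decompose: "\<exists>p h q. h \<in> carrier H \<and> z = p *s u + h + q *s d" if "z \<in> carrier A" for z
    using unsplit_split[of z] that by (metis (no_types) case_prod_conv proj_carrier_H split_def unsplit_def)
  obtain p h q p' h' q' where h: "h \<in> carrier H" "h' \<in> carrier H"
    and xy: "x = p *s u + h + q *s d" "y = p' *s u + h' + q' *s d"
    using decompose assms by metis
  have split_xy: "split x = (p, h, q)" "split y = (p', h', q')"
    using split_unsplit h by (simp_all add: xy unsplit_def)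
  have "x \<odot> y = h \<odot> h' + q *s (d \<odot> h') + q' *s (h \<odot> d) + (q * q') *s (d \<odot> d)"
    using h by (simp add: xy algebra_simps)
  then have "proj (x \<odot> y) = mult_H h h' + q *s left_d h' + q' *s right_d h + (q * q') *s (d \<odot> d)"
    and "form d (x \<odot> y) = form d (h \<odot> h') + q * form d (d \<odot> h') + q' * form d (h \<odot> d)"
    using h dd_even
    by (simp_all add: mult_H_def left_d_def right_d_def proj_add proj_scale proj_H dd_carrier_H)
  moreover have "form d (h \<odot> h') = form (left_d h) h'"
    using h by (simp add: left_d_def form_proj invariant)
  \<comment> \<open>Here \<open>z\<close> need not be homogeneous: as \<open>d d\<close> is even,
    only the even part of \<open>z\<close> contributes, and there the form is symmetric.\<close>
  moreover have symm: "form (d \<odot> d) z = form z (d \<odot> d)" if z: "z \<in> carrier A" for z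
  proof -
    obtain z0 z1 where "z0 \<in> A 0" "z1 \<in> A 1" "z = z0 + z1"
      using z by (rule carrierE)
    then show ?thesis
      using supersymmetric[OF dd_even, of z0 0] even_form[OF dd_even]
      by (simp add: part_subset_carrier)
  qed
  have "form d (d \<odot> h') = form h' (d \<odot> d)"
    using h symm by (simp flip: invariant)
  moreover have "form d (h \<odot> d) = - form h (d \<odot> d)"
    using h form_ud_commute(2)[of "h \<odot> d"] by (simp add: invariant)
  ultimately show ?thesis
    using assms by (simp add: split_xy) (simp add: split_def dext_mult_def)
qed

lemma isomorphic_dext:
  "superalgebra_isomorphic scale A mult
     (dext_scale scale) (dext_part H) (dext_mult scale mult_H form left_d right_d (d \<odot> d))"
  unfolding superalgebra_isomorphic_def
proof (intro exI[of _ split] conjI ballI allI)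
  show "bij_betw split (carrier A) (carrier (dext_part H))"
    by (metis bij_betw_def inj_on_inverseI split_carrier unsplit_split)
  show "linear_between scale (carrier A) (dext_scale scale) (carrier (dext_part H)) split"
    using split_carrier
    by (auto simp: linear_between_def split_add) (simp add: split_def dext_scale_def proj_scale)
qed (simp_all add: split_image split_mult)

section \<open>Dimension count and conclusion\<close>

lemma dim_odd: "dim (A 1) = dim (H 1) + 2"
proof -
  obtain B where B: "B \<subseteq> H 1" "independent B" "H 1 \<subseteq> span B" "card B = dim (H 1)"
    by (rule basis_exists)
  have span_B: "span B = H 1"
    using B subspace_H by (simp add: span_minimal subset_antisym)
  \<comment> \<open>Finiteness of \<open>B\<close> matters because \<open>card\<close> is 0 on
    infinite sets.\<close>
  obtain F where "finite F" "A 1 \<subseteq> span F"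
    using finite_dim_part by blast
  then have fin: "finite B"
    using B H_subset independent_span_bound[of F B] by blast
  have d_notin: "d \<notin> span B"
    by (auto simp: span_B H_def)
  have u_notin: "u \<notin> span (insert d B)"
  proof
    assume "u \<in> span (insert d B)"
    \<comment> \<open>Pairing with \<open>d\<close> yields the contradiction
      \<open>form d u = 0\<close>, since \<open>form d d = 0\<close>.\<close>
    then obtain k where "u - k *s d \<in> H 1"
      by (auto simp: span_insert span_B)
    then have "form d (u - k *s d) = 0"
      by (simp add: H_def)
    then show False by simp
  qed
  let ?C = "insert u (insert d B)"
  have "dim (A 1) = card ?C"
  proof (rule dim_unique)
    show "?C \<subseteq> A 1"
      using B u_odd d_odd H_subset by blast
    show "A 1 \<subseteq> span ?C"
    proof
      fix x assume "x \<in> A 1"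
      then have "proj x \<in> span B"
        by (simp add: span_B proj_part)
      then have "proj x \<in> span ?C"
        using span_mono[of B ?C] by blast
      then have "unsplit (split x) \<in> span ?C"
        by (simp add: unsplit_def split_def span_add span_diff span_scale span_base span_neg)
      then show "x \<in> span ?C" by (simp add: unsplit_split)
    qed
    show "independent ?C"
      using B d_notin u_notin by (simp add: independent_insert span_base)
  qed simp
  also have "\<dots> = dim (H 1) + 2"
    using fin B d_notin u_notin by (simp add: card_insert_if) (metis insertCI span_base)
  finally show ?thesis .
qed

end

theorem theorem35:
  fixes scale :: "'k::field \<Rightarrow> 'a::ab_group_add \<Rightarrow> 'a"
    and A :: "bit \<Rightarrow> 'a set"
    and mult :: "'a \<Rightarrow> 'a \<Rightarrow> 'a"
    and form :: "'a \<Rightarrow> 'a \<Rightarrow> 'k"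
    and n m :: nat
  assumes char_not_2: "(2::'k) \<noteq> 0"
    and quadratic: "quadratic_zinbiel_superalgebra scale A mult form"
    and dimension: "superdim scale A = (n, m)"
    and m_ge_2: "m \<ge> 2"
    and odd_annihilator: "annihilator A mult \<inter> A 1 \<noteq> {0}"
  shows "\<exists>(H :: bit \<Rightarrow> 'a set) (mult\<^sub>H :: 'a \<Rightarrow> 'a \<Rightarrow> 'a) (form\<^sub>H :: 'a \<Rightarrow> 'a \<Rightarrow> 'k)
            (\<delta> :: 'a \<Rightarrow> 'a) (D :: 'a \<Rightarrow> 'a) (a0 :: 'a).
           quadratic_zinbiel_superalgebra scale H mult\<^sub>H form\<^sub>H \<and>
           superdim scale H = (n, m - 2) \<and>
           odd_double_extension_data scale H mult\<^sub>H form\<^sub>H \<delta> D a0 \<and>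
           superalgebra_isomorphic scale A mult
             (dext_scale scale) (dext_part H) (dext_mult scale mult\<^sub>H form\<^sub>H \<delta> D a0)"
proof -
  interpret quadratic_zinbiel_superalgebra scale A mult form by (rule quadratic)
  \<comment> \<open>A set other than \<open>{0}\<close> could be empty; containing 0, it must have a
    nonzero element.\<close>
  have "0 \<in> annihilator A mult \<inter> A 1"
    using subspace_0[OF subspace_part] by (simp add: annihilator_def)
  with odd_annihilator obtain u where u: "u \<in> annihilator A mult" "u \<in> A 1" "u \<noteq> 0"
    by blast
  then obtain i y where y: "y \<in> A i" "form u y \<noteq> 0"
    using nondegenerateI part_subset_carrier by metis
  \<comment> \<open>An even form cannot pair the odd \<open>u\<close> with an even vector.\<close>
  have "i = 1"
    using y u even_form[of y u] by (cases i) auto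
  \<comment> \<open>Rescaling normalises the pairing to \<open>form u d = 1\<close>.\<close>
  define d where "d = scale (inverse (form u y)) y"
  interpret odd_hyperbolic_pair scale A mult form u d
  proof
    show "d \<in> A 1"
      using y \<open>i = 1\<close> by (simp add: d_def subspace_scale subspace_part)
    show "form u d = 1"
      using y u by (simp add: d_def part_subset_carrier)
  qed (use char_not_2 u in auto)
  have "superdim scale H = (n, m - 2)"
    using dimension dim_odd by (auto simp: superdim_def)
  with H.quadratic_zinbiel_superalgebra_axioms H.odd_double_extension_data_axioms isomorphic_dext
  show ?thesis by blast
qed

end
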